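(* Let $\mathcal{H}$ be a real Hilbert space and let $V:\mathcal{H}\to\mathcal{H}$ be a monotone and continuous operator. Let $t_0>0$, $r\in[0,1]$, $\alpha,\theta>0$ be such that - if $r\in[0,1)$, then $\frac{2}{\alpha}<\theta$; - if $r=1$, then $\frac{2}{\alpha+1}\le\theta<\frac12$. Let $\beta:[t_0,+\infty)\to(0,+\infty)$ be continuously differentiable and nondecreasing with $$\sup_{t\ge t_0} t^{r}\left(\frac{\dot\beta(t)}{\beta(t)}+\frac{2r}{t}\right)<\frac1\theta .$$ Let $z:[t_0,+\infty)\to\mathcal{H}$ be a solution to $$\ddot z(t)+\frac{\alpha}{t^{r}}\dot z(t)+\theta t^{r}\beta(t)\frac{d}{dt}V(z(t))+\beta(t)V(z(t))=0,\qquad t\ge t_0,$$ and let $z_*\in\mathcal{H}$ be a zero of $V$, i.e. $V(z_* )=0$. For $\rho\ge 0$ consider the convergence rates, as $t\to+\infty$, $$(R_\rho)\qquad \|V(z(t))\|=o\left(\frac{1}{t^{\rho+r}\beta(t)}\right),\quad \langle z(t)-z_*,V(z(t))\rangle=o\left(\frac{1}{t^{2\rho}\beta(t)}\right),\quad \|\dot z(t)\|=o\left(\frac{1}{t^{\rho}}\right).$$ Then: (i) If $r\in(0,1)$, then $(R_\rho)$ holds for every $\rho\in(0,r)$. Furthermore, if $t\mapsto z(t)$ is bounded, then $(R_\rho)$ holds for $\rho=r$. (ii) If $r=0$ or $r=1$, then $t\mapsto z(t)$ is bounded; moreover, $(R_\rho)$ holds with $\rho=0$ (if $r=0$) and with $\rho=1$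 (if $r=1$). (iii) If $r=0$, or $r=1$, or ($r\in(0,1)$ and $t\mapsto z(t)$ is bounded), then $z(t)$ converges weakly in $\mathcal{H}$ to a zero of $V$ as $t\to+\infty$.
   Context: An operator $V:\mathcal{H}\to\mathcal{H}$ is monotone if $\langle V(x)-V(y),x-y\rangle\ge0$ for all $x,y\in\mathcal{H}$. Dots denote derivatives with respect to $t$. For positive $g$, $f(t)=o(g(t))$ as $t\to+\infty$ means $f(t)/g(t)\to0$. A solution of the system is understood in the classical sense: $z$ is twice differentiable, $t\mapsto V(z(t))$ is differentiable, and the equation holds for every $t\ge t_0$. *)

theory Defs
  imports "HOL-Analysis.Analysis" "HOL-Library.Landau_Symbols"
begin

definition monotone_operator :: "('a::real_inner \<Rightarrow> 'a) \<Rightarrow> bool" where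
  "monotone_operator V \<longleftrightarrow> (\<forall>x y. inner (V x - V y) (x - y) \<ge> 0)"

(* Convergence in the weak topology of a Hilbert space, i.e. the coarsest topology making
   all the maps x \<mapsto> inner x y continuous. *)
definition weakly_tendsto :: "('b \<Rightarrow> 'a::real_inner) \<Rightarrow> 'a \<Rightarrow> 'b filter \<Rightarrow> bool" where
  "weakly_tendsto f l F \<longleftrightarrow> (\<forall>y. ((\<lambda>t. inner (f t) y) \<longlongrightarrow> inner l y) F)"

(* z' is meant to be the time derivative of z. *)
definition convergence_rates ::
  "('a::real_inner \<Rightarrow> 'a) \<Rightarrow> 'a \<Rightarrow> (real \<Rightarrow> real) \<Rightarrow> real \<Rightarrow>
   (real \<Rightarrow> 'a) \<Rightarrow> (real \<Rightarrow> 'a) \<Rightarrow> real \<Rightarrow> bool" where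
  "convergence_rates V zs \<beta> r z z' \<rho> \<longleftrightarrow>
     (\<lambda>t. norm (V (z t))) \<in> o[at_top](\<lambda>t. 1 / (t powr (\<rho> + r) * \<beta> t)) \<and>
     (\<lambda>t. inner (z t - zs) (V (z t))) \<in> o[at_top](\<lambda>t. 1 / (t powr (2 * \<rho>) * \<beta> t)) \<and>
     (\<lambda>t. norm (z' t)) \<in> o[at_top](\<lambda>t. 1 / t powr \<rho>)"

end

theory Submission
  imports Defs
begin

text \<open>Write \<open>a = t\<^sup>r\<close>, \<open>u = z - z\<^sub>*\<close>, \<open>w = V z\<close>, \<open>B = \<theta> a\<^sup>2 \<beta>\<close> and \<open>P = a z' + B w\<close>. The equation turns the
  derivative of \<open>P\<close> into a combination of \<open>z'\<close> and \<open>w\<close>, free of the derivative of \<open>w\<close>. With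
  \<open>\<delta> = lim a'\<close>, put \<open>\<phi> = (\<alpha> - \<delta>)/2 |u|\<^sup>2 + \<langle>u, P\<rangle>\<close> and \<open>\<psi> = |P|\<^sup>2 + |a z'|\<^sup>2\<close>. For all \<open>\<mu>\<close> near
  \<open>((\<alpha> - \<delta>) \<theta> + 1) / (2 \<theta>)\<close> the energy \<open>4 \<mu> \<phi> + \<psi>\<close> dominates a multiple of \<open>|u|\<^sup>2\<close> and is dissipated
  at a rate proportional to \<open>\<psi> / a\<close>, up to an error \<open>C t\<^sup>r\<^sup>-\<^sup>2 |u|\<^sup>2\<close> (absent for \<open>r = 1\<close>), which is
  integrable. Hence \<open>u\<close> is bounded for every \<open>r\<close> and the energy converges; two values of \<open>\<mu>\<close> give
  limits of \<open>\<phi>\<close> and of \<open>\<psi>\<close> separately. As \<open>1 / a\<close> is not integrable, \<open>\<psi>\<close> tends to \<open>0\<close>. This gives the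
  rates with \<open>\<rho> = r\<close>, and then the limit of \<open>\<phi>\<close> gives that of \<open>|u|\<close>, so that Opial's argument
  applies.\<close>

section \<open>Weak convergence\<close>

text \<open>Near-minimisers of the norm over the sets \<open>C n\<close> form a Cauchy sequence, by
  the parallelogram law as in the projection theorem, and their limit lies in every
  \<open>C n\<close>. This takes the place of weak compactness.\<close>

lemma nested_closed_convex_Inter_nonempty:
  fixes C :: "nat \<Rightarrow> 'a::{real_inner,complete_space} set"
  assumes closed: "\<And>n. closed (C n)" and convex: "\<And>n. convex (C n)"
    and nonempty: "\<And>n. C n \<noteq> {}" and bounded: "bounded (C 0)" and dec: "decseq C"
  shows "(\<Inter>n. C n) \<noteq> {}"
proof -
  define d where "d n = Inf ((\<lambda>x. norm x ^ 2) ` C n)" for n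
  have bdd: "bdd_below ((\<lambda>x. norm x ^ 2) ` C n)" for n
    by (rule bdd_belowI2[where m = 0]) simp
  obtain K where K: "\<And>x. x \<in> C 0 \<Longrightarrow> norm x \<le> K"
    using bounded by (auto simp: bounded_iff)
  have sub: "C n \<subseteq> C m" if "m \<le> n" for m n
    using dec that by (simp add: decseq_def)
  have d_le: "d n \<le> norm x ^ 2" if "x \<in> C n" for n x
    unfolding d_def by (rule cINF_lower[OF bdd that])
  have "mono d"
  proof (rule monoI)
    fix m n :: nat assume "m \<le> n"
    then show "d m \<le> d n"
      unfolding d_def by (rule cINF_superset_mono[OF nonempty bdd sub]) simp
  qed
  moreover have "d n \<le> K ^ 2" for n
  proof -
    obtain x where x: "x \<in> C n" using nonempty by blast
    then have "norm x \<le> K" using K sub[of 0 n] by blast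
    then show ?thesis
      using d_le[OF x] power_mono[of "norm x" K 2] by simp
  qed
  ultimately obtain D where D: "d \<longlonglongrightarrow> D" and dD: "\<And>n. d n \<le> D"
    using incseq_convergent[of d "K\<^sup>2"] incseq_le[of d] by blast
  have "\<exists>x. x \<in> C n \<and> norm x ^ 2 < d n + inverse (real (Suc n))" for n
  proof -
    have "\<exists>y\<in>(\<lambda>x. norm x ^ 2) ` C n. y < d n + inverse (real (Suc n))"
      by (rule cInf_lessD) (use nonempty in \<open>auto simp: d_def\<close>)
    then show ?thesis by blast
  qed
  then obtain x where xC: "\<And>n. x n \<in> C n"
    and xd: "\<And>n. norm (x n) ^ 2 < d n + inverse (real (Suc n))" by metis
  \<comment> \<open>Convexity puts the midpoint of \<open>x m\<close> and \<open>x n\<close> into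
    \<open>C n\<close>, so its squared norm is at least \<open>d n\<close>; the parallelogram law
    turns this into a bound on the difference.\<close>
  have close: "norm (x m - x n) ^ 2 \<le> 4 * (D - d n) + 4 * inverse (real (Suc n))"
    if mn: "n \<le> m" for m n
  proof -
    have "x m \<in> C n" using xC sub[OF mn] by blast
    then have "(1/2) *\<^sub>R x m + (1/2) *\<^sub>R x n \<in> C n"
      using xC[of n] convex[of n] by (simp add: convex_def)
    from d_le[OF this] have "4 * d n \<le> norm (x m + x n) ^ 2"
      by (simp add: power_mult_distrib power_divide flip: scaleR_add_right)
    moreover have "norm (x m - x n) ^ 2 + norm (x m + x n) ^ 2 = 2 * norm (x m) ^ 2 + 2 * norm (x n) ^ 2"
      by (simp add: power2_norm_eq_inner algebra_simps inner_commute diff_divide_distrib)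
    moreover have "inverse (real (Suc m)) \<le> inverse (real (Suc n))"
      using mn by simp
    ultimately show ?thesis using xd[of m] xd[of n] dD[of m] dD[of n] by argo
  qed
  have "Cauchy x"
  proof (rule metric_CauchyI)
    fix \<epsilon> :: real assume \<epsilon>: "\<epsilon> > 0"
    have "(\<lambda>n. 4 * (D - d n) + 4 * inverse (real (Suc n))) \<longlonglongrightarrow> 4 * (D - D) + 4 * 0"
      by (intro tendsto_intros D LIMSEQ_inverse_real_of_nat)
    then have "\<forall>\<^sub>F n in sequentially. 4 * (D - d n) + 4 * inverse (real (Suc n)) < (\<epsilon>/2)\<^sup>2"
      by (rule order_tendstoD) (use \<epsilon> in auto)
    then obtain N where N: "4 * (D - d N) + 4 * inverse (real (Suc N)) < (\<epsilon>/2)\<^sup>2"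
      by (auto simp: eventually_sequentially)
    have "dist (x m) (x N) < \<epsilon>/2" if "m \<ge> N" for m
      using le_less_trans[OF close[OF that] N] \<epsilon> power_less_imp_less_base[of _ 2 "\<epsilon>/2"]
      by (simp add: dist_norm)
    then show "\<exists>M. \<forall>m\<ge>M. \<forall>n\<ge>M. dist (x m) (x n) < \<epsilon>"
      by (meson dist_triangle_half_l)
  qed
  then obtain l where l: "x \<longlonglongrightarrow> l" using Cauchy_convergent_iff convergent_def by blast
  have "l \<in> C n" for n
  proof (rule Lim_in_closed_set[OF closed _ _ l])
    show "\<forall>\<^sub>F m in sequentially. x m \<in> C n"
      using eventually_ge_at_top[of n] by eventually_elim (rule subsetD[OF sub xC])
  qed simp
  then show ?thesis by blast
qed

text \<open>Any point common to the closed convex hulls of the tails of \<open>z\<close> along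
  \<open>P\<close> works, since a closed half-space containing a tail contains its hull. The
  predicate \<open>P\<close> plays the role of a subsequence.\<close>

lemma weak_cluster_point:
  fixes z :: "real \<Rightarrow> 'a::{real_inner,complete_space}"
  assumes bounded: "bounded (z ` {t0..})" and freq: "\<exists>\<^sub>F t in at_top. P t"
  shows "\<exists>x. \<forall>v c. (\<forall>\<^sub>F t in at_top. P t \<longrightarrow> c \<le> inner v (z t)) \<longrightarrow> c \<le> inner v x"
proof -
  define C where "C n = closure (convex hull (z ` {t. P t \<and> t0 + real n \<le> t}))" for n
  have "(\<Inter>n. C n) \<noteq> {}"
  proof (rule nested_closed_convex_Inter_nonempty)
    show "C n \<noteq> {}" for n
      using freq by (force simp: C_def frequently_def eventually_at_top_linorder)
    show "bounded (C 0)"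
      unfolding C_def
      by (intro bounded_closure bounded_convex_hull bounded_subset[OF bounded]) auto
    show "decseq C"
      unfolding C_def by (intro decseq_SucI closure_mono hull_mono) auto
  qed (auto simp: C_def intro!: convex_closure)
  then obtain x where x: "\<And>n. x \<in> C n" by blast
  show ?thesis
  proof (intro exI allI impI)
    fix v c assume "\<forall>\<^sub>F t in at_top. P t \<longrightarrow> c \<le> inner v (z t)"
    then obtain T where T: "\<And>t. t \<ge> T \<Longrightarrow> P t \<Longrightarrow> c \<le> inner v (z t)"
      by (auto simp: eventually_at_top_linorder)
    obtain n where n: "T - t0 \<le> real n" using real_arch_simple by blast
    have "C n \<subseteq> {y. c \<le> inner v y}"
      unfolding C_def
      by (intro closure_minimal hull_minimal convex_halfspace_ge closed_halfspace_ge)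
         (use T n in auto)
    then show "c \<le> inner v x" using x by blast
  qed
qed

text \<open>Minty's trick: test with \<open>y = x - s *\<^sub>R V x\<close>, divide by
  \<open>s > 0\<close> and let \<open>s\<close> tend to \<open>0\<close>.\<close>

lemma monotone_operator_zero_minty:
  fixes V :: "'a::real_inner \<Rightarrow> 'a"
  assumes cont: "continuous_on UNIV V" and ge: "\<And>y. inner (V y) (y - x) \<ge> 0"
  shows "V x = 0"
proof -
  have "((\<lambda>s. inner (V (x - s *\<^sub>R V x)) (V x)) \<longlongrightarrow> inner (V (x - 0 *\<^sub>R V x)) (V x)) (at_right 0)"
    using cont
    by (intro tendsto_inner isCont_tendsto_compose[where g = V] tendsto_diff tendsto_scaleR tendsto_const
        tendsto_ident_at) (simp add: continuous_on_eq_continuous_at)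
  moreover have "\<forall>\<^sub>F s in at_right 0. inner (V (x - s *\<^sub>R V x)) (V x) \<le> (0::real)"
    using eventually_at_right_less[of 0]
  proof eventually_elim
    case (elim s)
    then show ?case using ge[of "x - s *\<^sub>R V x"] by (simp add: mult_le_0_iff zero_le_mult_iff)
  qed
  ultimately have "inner (V x) (V x) \<le> 0"
    using tendsto_upperbound by force
  then show ?thesis by (metis inner_ge_zero inner_eq_zero_iff order_antisym)
qed

text \<open>An Opial argument without weak compactness: a weak cluster point is replaced by a point of
  the intersection of the closed convex hulls of the tails.\<close>

lemma weakly_tendsto_zero_of_monotone_operator:
  fixes z :: "real \<Rightarrow> 'a::{real_inner,complete_space}"
  assumes mono: "monotone_operator V" and cont: "continuous_on UNIV V"
    and bounded: "bounded (z ` {t0..})"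
    and Vz: "((\<lambda>t. V (z t)) \<longlongrightarrow> 0) at_top"
    and dist: "\<And>p. V p = 0 \<Longrightarrow> \<exists>l. ((\<lambda>t. norm (z t - p)) \<longlongrightarrow> l) at_top"
  shows "\<exists>l. V l = 0 \<and> weakly_tendsto z l at_top"
proof -
  obtain K where K: "\<And>t. t \<ge> t0 \<Longrightarrow> norm (z t) \<le> K"
    using bounded by (auto simp: bounded_iff)
  \<comment> \<open>Monotonicity bounds \<open>inner (V y) (z t - y)\<close> by
    \<open>inner (V (z t)) (z t - y)\<close>, which tends to \<open>0\<close> because
    \<open>z\<close> is bounded. The resulting half-space condition passes to \<open>x\<close>,
    where Minty's trick applies.\<close>
  have zero: "V x = 0"
    if x: "\<And>v c. \<forall>\<^sub>F t in at_top. P t \<longrightarrow> c \<le> inner v (z t) \<Longrightarrow> c \<le> inner v x" for P x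
  proof (rule monotone_operator_zero_minty[OF cont])
    fix y :: 'a
    have lim: "((\<lambda>t. norm (V (z t)) * (norm y + K)) \<longlongrightarrow> norm (0::'a) * (norm y + K)) at_top"
      by (intro tendsto_intros Vz)
    have "inner (V y) (x - y) \<le> \<epsilon>" if "\<epsilon> > 0" for \<epsilon>
    proof -
      have "\<forall>\<^sub>F t in at_top. norm (V (z t)) * (norm y + K) < \<epsilon>"
        by (rule order_tendstoD(2)[OF lim]) (use that in simp)
      then have "\<forall>\<^sub>F t in at_top. - inner (V y) y - \<epsilon> \<le> inner (- V y) (z t)"
        using eventually_ge_at_top[of t0]
      proof eventually_elim
        case (elim t)
        have "0 \<le> inner (V y - V (z t)) (y - z t)"
          using mono by (simp add: monotone_operator_def)
        moreover have "- inner (V (z t)) (y - z t) \<le> norm (V (z t)) * norm (y - z t)"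
          using Cauchy_Schwarz_ineq2[of "V (z t)" "y - z t"] by linarith
        moreover have "norm (V (z t)) * norm (y - z t) \<le> norm (V (z t)) * (norm y + K)"
          using K[OF elim(2)] norm_triangle_ineq4[of y "z t"] by (intro mult_left_mono) auto
        ultimately show ?case using elim(1) by (simp add: inner_diff_left inner_diff_right)
      qed
      then have "- inner (V y) y - \<epsilon> \<le> inner (- V y) x"
        by (intro x) (erule eventually_mono, simp)
      then show ?thesis by (simp add: inner_diff_right)
    qed
    then have "inner (V y) (x - y) \<le> 0" by (rule field_le_epsilon) simp
    then show "0 \<le> inner (V y) (y - x)" by (simp add: inner_diff_right)
  qed
  have frequently_True: "\<exists>\<^sub>F t::real in at_top. True" by simp
  obtain c where c: "\<And>v k. \<forall>\<^sub>F t in at_top. True \<longrightarrow> k \<le> inner v (z t) \<Longrightarrow> k \<le> inner v c"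
    using weak_cluster_point[OF bounded frequently_True] by blast
  have Vc: "V c = 0" by (rule zero[OF c])
  \<comment> \<open>A one-sided bound, used below for \<open>y\<close> and \<open>- y\<close>. If it
    failed, the violating times would have a cluster point \<open>x\<close> with
    \<open>inner (x - c) y\<close> at least \<open>\<epsilon>\<close>, while convergence of the
    distances to the zeros \<open>c\<close> and \<open>x\<close> forces
    \<open>x = c\<close>.\<close>
  have le: "\<forall>\<^sub>F t in at_top. inner (z t - c) y < \<epsilon>" if \<epsilon>: "\<epsilon> > 0" for y \<epsilon>
  proof (rule ccontr)
    assume "\<not> ?thesis"
    then have "\<exists>\<^sub>F t in at_top. \<not> inner (z t - c) y < \<epsilon>" by (simp add: not_eventually)
    then obtain x where
      x: "\<And>v k. \<forall>\<^sub>F t in at_top. \<not> inner (z t - c) y < \<epsilon> \<longrightarrow> k \<le> inner v (z t) \<Longrightarrow> k \<le> inner v x"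
      using weak_cluster_point[OF bounded] by blast
    have Vx: "V x = 0" by (rule zero[OF x])
    obtain lc lx where lc: "((\<lambda>t. norm (z t - c)) \<longlongrightarrow> lc) at_top"
      and lx: "((\<lambda>t. norm (z t - x)) \<longlongrightarrow> lx) at_top"
      using dist[OF Vc] dist[OF Vx] by blast
    \<comment> \<open>The squares of \<open>z t\<close> cancel in the difference of the squared
      distances, so \<open>inner (x - c) (z t)\<close> converges along all times.\<close>
    define l where "l = (lc ^ 2 - lx ^ 2 + inner x x - inner c c) / 2"
    have "((\<lambda>t. (norm (z t - c) ^ 2 - norm (z t - x) ^ 2 + inner x x - inner c c) / 2) \<longlongrightarrow> l) at_top"
      unfolding l_def by (intro tendsto_intros lc lx) simp
    also have "(\<lambda>t. (norm (z t - c) ^ 2 - norm (z t - x) ^ 2 + inner x x - inner c c) / 2)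
        = (\<lambda>t. inner (x - c) (z t))"
      by (simp add: power2_norm_eq_inner algebra_simps inner_commute diff_divide_distrib)
    finally have l: "((\<lambda>t. inner (x - c) (z t)) \<longlongrightarrow> l) at_top" .
    \<comment> \<open>The limit \<open>l\<close> passes to both cluster points, because it holds
      along all times and hence also along the violating ones.\<close>
    have above: "l - \<delta> \<le> inner (x - c) c" "l - \<delta> \<le> inner (x - c) x"
      and below: "- l - \<delta> \<le> inner (- (x - c)) c" "- l - \<delta> \<le> inner (- (x - c)) x"
      if "\<delta> > 0" for \<delta>
    proof -
      have lower: "\<forall>\<^sub>F t in at_top. l - \<delta> < inner (x - c) (z t)"
        and upper: "\<forall>\<^sub>F t in at_top. inner (x - c) (z t) < l + \<delta>"
        using order_tendstoD[OF l] that by auto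
      show "l - \<delta> \<le> inner (x - c) c"
        by (rule c, rule eventually_mono[OF lower]) simp
      show "l - \<delta> \<le> inner (x - c) x"
        by (rule x, rule eventually_mono[OF lower]) simp
      show "- l - \<delta> \<le> inner (- (x - c)) c"
        by (rule c, rule eventually_mono[OF upper]) (simp add: inner_diff_left)
      show "- l - \<delta> \<le> inner (- (x - c)) x"
        by (rule x, rule eventually_mono[OF upper]) (simp add: inner_diff_left)
    qed
    have "l \<le> inner (x - c) c"
      by (rule field_le_epsilon) (use above(1) in \<open>simp add: diff_le_eq\<close>)
    moreover have "inner (x - c) x \<le> l"
      by (rule field_le_epsilon) (use below(2) in \<open>fastforce simp: inner_diff_left\<close>)
    ultimately have "inner (x - c) (x - c) \<le> 0" by (simp add: inner_diff_right)
    then have "x = c" by (metis inner_ge_zero inner_eq_zero_iff order_antisym eq_iff_diff_eq_0)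
    moreover have "inner c y + \<epsilon> \<le> inner y x"
      by (rule x, rule always_eventually) (auto simp: inner_diff_left inner_commute[of y])
    ultimately show False using \<epsilon> by (simp add: inner_commute)
  qed
  have "weakly_tendsto z c at_top"
    unfolding weakly_tendsto_def
  proof (intro allI tendstoI)
    fix y and \<epsilon> :: real assume "\<epsilon> > 0"
    from le[OF this, of y] le[OF this, of "- y"]
    show "\<forall>\<^sub>F t in at_top. dist (inner (z t) y) (inner c y) < \<epsilon>"
      by eventually_elim (simp add: dist_real_def inner_diff_left)
  qed
  with Vc show ?thesis by blast
qed

section \<open>Dissipative inequalities\<close>

lemma has_vector_derivative_quotient_tendsto:
  assumes "(f has_vector_derivative f') (at t)"
  shows "((\<lambda>s. (f s - f t) /\<^sub>R (s - t)) \<longlongrightarrow> f') (at t)"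
proof -
  have "((\<lambda>s. norm ((f s - (f t + (s - t) *\<^sub>R f')) /\<^sub>R \<bar>s - t\<bar>)) \<longlongrightarrow> 0) (at t)"
    using assms unfolding has_vector_derivative_def has_derivative_at2
    by (auto simp: inverse_eq_divide intro!: tendsto_norm_zero simp del: norm_scaleR)
  moreover have "\<forall>\<^sub>F s in at t. norm ((f s - (f t + (s - t) *\<^sub>R f')) /\<^sub>R \<bar>s - t\<bar>)
      = norm ((f s - f t) /\<^sub>R (s - t) - f')"
  proof -
    have "norm ((f s - (f t + (s - t) *\<^sub>R f')) /\<^sub>R \<bar>s - t\<bar>) = norm ((f s - f t) /\<^sub>R (s - t) - f')"
      if "s \<noteq> t" for s
    proof -
      have "(f s - f t) /\<^sub>R (s - t) - f' = (f s - (f t + (s - t) *\<^sub>R f')) /\<^sub>R (s - t)"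
        using that by (simp add: scaleR_diff_right scaleR_add_right)
      then show ?thesis by simp
    qed
    then show ?thesis by (auto simp: eventually_at intro: exI[of _ 1])
  qed
  ultimately have "((\<lambda>s. norm ((f s - f t) /\<^sub>R (s - t) - f')) \<longlongrightarrow> 0) (at t)"
    by (rule Lim_transform_eventually)
  then show ?thesis by (simp add: tendsto_norm_zero_iff LIM_zero_iff)
qed

text \<open>Monotonicity makes the inner product of the difference quotients of \<open>z\<close> and
  of \<open>V\<close> along \<open>z\<close> nonnegative, and this survives in the limit. Only
  differentiability along the path enters.\<close>

lemma monotone_inner_derivative_nonneg:
  assumes mono: "monotone_operator V"
    and z: "(z has_vector_derivative z') (at t)"
    and W: "((\<lambda>s. V (z s)) has_vector_derivative W') (at t)"
  shows "0 \<le> inner z' W'"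
proof (rule tendsto_lowerbound)
  show "((\<lambda>s. inner ((z s - z t) /\<^sub>R (s - t)) ((V (z s) - V (z t)) /\<^sub>R (s - t))) \<longlongrightarrow> inner z' W') (at t)"
    by (intro tendsto_inner has_vector_derivative_quotient_tendsto z W)
  show "\<forall>\<^sub>F s in at t. 0 \<le> inner ((z s - z t) /\<^sub>R (s - t)) ((V (z s) - V (z t)) /\<^sub>R (s - t))"
  proof (rule always_eventually, rule allI)
    fix s
    have "0 \<le> inner (z s - z t) (V (z s) - V (z t))"
      using mono by (simp add: monotone_operator_def inner_commute)
    then show "0 \<le> inner ((z s - z t) /\<^sub>R (s - t)) ((V (z s) - V (z t)) /\<^sub>R (s - t))"
      by (simp add: zero_le_mult_iff flip: mult.assoc power2_eq_square)
  qed
qed simp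

lemma has_real_derivative_inner:
  assumes "(f has_vector_derivative f') (at x)" and "(g has_vector_derivative g') (at x)"
  shows "((\<lambda>t. inner (f t) (g t)) has_real_derivative inner (f x) g' + inner f' (g x)) (at x)"
  using bounded_bilinear.has_vector_derivative[OF bounded_bilinear_inner assms]
  by (simp add: has_real_derivative_iff_has_vector_derivative)

text \<open>The weight of the mixed term is \<open>e\<close> up to a perturbation, and \<open>e \<le> Q\<close> makes the
  unperturbed form negative definite.\<close>

lemma perturbed_quadratic_form_le:
  fixes x y :: real
  assumes "0 \<le> x" "0 \<le> y" "\<epsilon> \<le> e" "e \<le> Q" "\<bar>s\<bar> \<le> \<epsilon> / 16" "\<bar>h\<bar> \<le> \<epsilon> / 16"
    and \<xi>: "\<bar>\<xi>\<bar> \<le> x * y"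
  shows "- 2 * (Q - s) * x\<^sup>2 + 4 * h * x\<^sup>2 - 2 * (e - s - h) * \<xi> - 2 * e * y\<^sup>2 \<le> - (\<epsilon> / 2) * (x\<^sup>2 + y\<^sup>2)"
proof -
  have \<epsilon>: "0 \<le> \<epsilon>" using assms by linarith
  have "- (2 * (e - s - h) * \<xi>) \<le> 2 * (e + \<epsilon> / 8) * (x * y)"
  proof -
    have "\<bar>2 * (e - s - h) * \<xi>\<bar> \<le> (2 * (e + \<epsilon> / 8)) * (x * y)"
      unfolding abs_mult using assms by (intro mult_mono) auto
    then show ?thesis by linarith
  qed
  moreover have "2 * (e + \<epsilon> / 8) * (x * y) \<le> (e + \<epsilon> / 8) * (x\<^sup>2 + y\<^sup>2)"
    using mult_left_mono[OF sum_squares_bound[of x y], of "e + \<epsilon> / 8"] \<epsilon> assms by (simp add: mult_ac)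
  moreover have "s * x\<^sup>2 \<le> \<epsilon> / 16 * x\<^sup>2" "h * x\<^sup>2 \<le> \<epsilon> / 16 * x\<^sup>2"
    using assms by (intro mult_right_mono; simp)+
  moreover have "e * x\<^sup>2 \<le> Q * x\<^sup>2" "\<epsilon> * x\<^sup>2 \<le> Q * x\<^sup>2" "\<epsilon> * y\<^sup>2 \<le> e * y\<^sup>2"
    using assms by (auto intro!: mult_right_mono)
  moreover have "0 \<le> \<epsilon> * x\<^sup>2" "0 \<le> \<epsilon> * y\<^sup>2" using \<epsilon> by auto
  \<comment> \<open>The coefficient of \<open>x\<^sup>2\<close> is at most
    \<open>- 2 * Q + e + \<epsilon> / 2\<close> and that of \<open>y\<^sup>2\<close> at most
    \<open>- e + \<epsilon> / 8\<close>; both are at most \<open>- \<epsilon> / 2\<close> because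
    \<open>\<epsilon> \<le> e \<le> Q\<close>.\<close>
  ultimately show ?thesis by (simp add: algebra_simps)
qed

text \<open>If \<open>L > 0\<close>, then \<open>F + k * g\<close> is eventually nonincreasing for
  some \<open>k > 0\<close>, which is impossible as \<open>F\<close> is nonnegative and
  \<open>g\<close> unbounded above.\<close>

lemma dissipation_limit_zero:
  fixes F F' G a g :: "real \<Rightarrow> real"
  assumes F: "\<And>t. t \<ge> T \<Longrightarrow> (F has_real_derivative F' t) (at t)"
    and F_nonneg: "\<And>t. t \<ge> T \<Longrightarrow> F t \<ge> 0"
    and dissip: "\<And>t. t \<ge> T \<Longrightarrow> F' t \<le> - c * (G t / a t)" and c: "c > 0"
    and a: "\<And>t. t \<ge> T \<Longrightarrow> a t > 0"
    and g: "\<And>t. t \<ge> T \<Longrightarrow> (g has_real_derivative 1 / a t) (at t)" "filterlim g at_top at_top"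
    and G_nonneg: "\<And>t. t \<ge> T \<Longrightarrow> G t \<ge> 0" and lim: "(G \<longlongrightarrow> L) at_top"
  shows "L = 0"
proof (rule ccontr)
  assume "L \<noteq> 0"
  moreover have "L \<ge> 0"
    by (rule tendsto_lowerbound[OF lim]) (auto intro: eventually_mono[OF eventually_ge_at_top[of T]] G_nonneg)
  ultimately have L: "L > 0" by simp
  then have "\<forall>\<^sub>F t in at_top. G t > L / 2" by (intro order_tendstoD(1)[OF lim]) simp
  then have "\<forall>\<^sub>F t in at_top. G t > L / 2 \<and> t \<ge> T"
    using eventually_ge_at_top by (rule eventually_conj)
  then obtain S where S: "\<And>t. t \<ge> S \<Longrightarrow> G t > L / 2" "S \<ge> T"
    by (auto simp: eventually_at_top_linorder)
  define k where "k = c * L / 2"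
  have k: "k > 0" using c L by (simp add: k_def)
  have decr: "F t + k * g t \<le> F S + k * g S" if "t \<ge> S" for t
  proof (rule DERIV_nonpos_imp_nonincreasing[OF that])
    fix u assume u: "S \<le> u" "u \<le> t"
    have "((\<lambda>t. F t + k * g t) has_real_derivative F' u + k * (1 / a u)) (at u)"
      using F[of u] g(1)[of u] u S by (auto intro!: derivative_eq_intros)
    moreover have "F' u + k * (1 / a u) \<le> 0"
    proof -
      have "c * (L / 2) / a u \<le> c * G u / a u"
        using S u a[of u] c by (intro divide_right_mono mult_left_mono) (auto intro: less_imp_le)
      then show ?thesis using dissip[of u] u S by (simp add: k_def)
    qed
    ultimately show "\<exists>y. ((\<lambda>t. F t + k * g t) has_real_derivative y) (at u) \<and> y \<le> 0" by blast
  qed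
  have "\<forall>\<^sub>F t in at_top. g t > (F S + k * g S) / k"
    using g(2) by (simp add: filterlim_at_top_dense)
  then have "\<forall>\<^sub>F t in at_top. g t > (F S + k * g S) / k \<and> t \<ge> S"
    using eventually_ge_at_top by (rule eventually_conj)
  then obtain t where "g t > (F S + k * g S) / k" and t: "t \<ge> S"
    using eventually_happens trivial_limit_at_top_linorder by fastforce
  then have "k * g t > F S + k * g S" using k by (simp add: field_simps)
  then show False using decr[OF t] F_nonneg[of t] t S(2) by linarith
qed

lemma antimono_bounded_below_convergent:
  fixes F :: "real \<Rightarrow> real"
  assumes dec: "\<And>s t. T \<le> s \<Longrightarrow> s \<le> t \<Longrightarrow> F t \<le> F s" and bd: "\<And>t. t \<ge> T \<Longrightarrow> b \<le> F t"
  shows "\<exists>l. (F \<longlongrightarrow> l) at_top"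
proof -
  have bdd: "bdd_below (F ` {T..})" using bd by (auto intro!: bdd_belowI2)
  define l where "l = Inf (F ` {T..})"
  have "(F \<longlongrightarrow> l) at_top"
  proof (rule order_tendstoI)
    fix y assume "y < l"
    then have "\<forall>t\<ge>T. y < F t"
      using cINF_lower[OF bdd] unfolding l_def by (meson atLeast_iff less_le_trans)
    then show "\<forall>\<^sub>F t in at_top. y < F t" by (auto simp: eventually_at_top_linorder)
  next
    fix y assume "l < y"
    then obtain s where "s \<ge> T" "F s < y"
      using cInf_lessD[of "F ` {T..}" y] by (auto simp: l_def)
    then show "\<forall>\<^sub>F t in at_top. F t < y"
      using dec by (auto simp: eventually_at_top_linorder intro!: exI[of _ s] intro: le_less_trans)
  qed
  then show ?thesis by blast
qed

section \<open>The energy functional\<close>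

text \<open>Below, \<open>a t = t powr r\<close> and \<open>\<delta>\<close> is the limit of its derivative. The function \<open>e\<close> is
  \<open>1 - B' / (a \<beta>)\<close> with \<open>B = \<theta> a\<^sup>2 \<beta>\<close>; it is bounded away from \<open>0\<close> by the growth condition on \<open>\<beta>\<close>.
  The functions \<open>m\<close> (tail integral of \<open>\<eta>\<^sup>2 / a\<close>, used in an integrating factor) and \<open>g\<close> express the
  integrability of \<open>\<eta>\<^sup>2 / a\<close> and the divergence of the integral of \<open>1 / a\<close>.\<close>

locale damped_flow =
  fixes V :: "'a::{real_inner,complete_space} \<Rightarrow> 'a" and t0 \<alpha> \<theta> \<delta> \<epsilon> :: real
    and a \<eta> \<beta> \<beta>' e m g :: "real \<Rightarrow> real"
    and z z' z'' W' :: "real \<Rightarrow> 'a"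
  assumes V_mono: "monotone_operator V"
    and \<theta>_pos: "\<theta> > 0" and \<epsilon>_pos: "\<epsilon> > 0"
    and e_ge: "\<And>t. t > t0 \<Longrightarrow> \<epsilon> \<le> e t"
    and e_le: "\<And>t. t > t0 \<Longrightarrow> e t \<le> (\<alpha> - \<delta>) * \<theta> - 1"
    and a_pos: "\<And>t. t > t0 \<Longrightarrow> a t > 0"
    and a_deriv: "\<And>t. t > t0 \<Longrightarrow> (a has_real_derivative \<delta> + \<eta> t) (at t)"
    and \<beta>_pos: "\<And>t. t > t0 \<Longrightarrow> \<beta> t > 0"
    and \<beta>_deriv: "\<And>t. t > t0 \<Longrightarrow> (\<beta> has_real_derivative \<beta>' t) (at t)"
    and growth: "\<And>t. t > t0 \<Longrightarrow> \<theta> * (2 * (\<delta> + \<eta> t) * \<beta> t + a t * \<beta>' t) = (1 - e t) * \<beta> t"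
    and \<eta>_lim: "(\<eta> \<longlongrightarrow> 0) at_top"
    and m_deriv: "\<And>t. t > t0 \<Longrightarrow> (m has_real_derivative - ((\<eta> t)\<^sup>2 / a t)) (at t)"
    and m_nonneg: "\<And>t. t > t0 \<Longrightarrow> m t \<ge> 0"
    and m_lim: "(m \<longlongrightarrow> 0) at_top"
    and g_deriv: "\<And>t. t > t0 \<Longrightarrow> (g has_real_derivative 1 / a t) (at t)"
    and g_lim: "filterlim g at_top at_top"
    and z_cont: "continuous_on {t0..} z"
    and z_deriv: "\<And>t. t > t0 \<Longrightarrow> (z has_vector_derivative z' t) (at t)"
    and z'_deriv: "\<And>t. t > t0 \<Longrightarrow> (z' has_vector_derivative z'' t) (at t)"
    and Vz_deriv: "\<And>t. t > t0 \<Longrightarrow> ((\<lambda>s. V (z s)) has_vector_derivative W' t) (at t)"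
    and ode: "\<And>t. t > t0 \<Longrightarrow>
      z'' t + (\<alpha> / a t) *\<^sub>R z' t + (\<theta> * a t * \<beta> t) *\<^sub>R W' t + \<beta> t *\<^sub>R V (z t) = 0"
begin

definition A :: real where "A = \<alpha> - \<delta>"
definition B :: "real \<Rightarrow> real" where "B t = \<theta> * (a t)\<^sup>2 * \<beta> t"
definition R :: "real \<Rightarrow> 'a" where "R t = a t *\<^sub>R z' t"
definition P :: "real \<Rightarrow> 'a" where "P t = R t + B t *\<^sub>R V (z t)"
definition \<phi> :: "'a \<Rightarrow> real \<Rightarrow> real" where
  "\<phi> p t = A / 2 * inner (z t - p) (z t - p) + inner (z t - p) (P t)"
definition \<psi> :: "real \<Rightarrow> real" where "\<psi> t = inner (P t) (P t) + inner (R t) (R t)"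
definition energy :: "real \<Rightarrow> 'a \<Rightarrow> real \<Rightarrow> real" where
  "energy \<mu> p t = 4 * \<mu> * \<phi> p t + \<psi> t"

section \<open>Derivatives of the building blocks of the energy\<close>

lemma inner_zero_nonneg: "V p = 0 \<Longrightarrow> 0 \<le> inner (z t - p) (V (z t))"
  using V_mono unfolding monotone_operator_def by (metis diff_zero inner_commute)

lemma Q_ge: "\<epsilon> \<le> A * \<theta> - 1"
  using e_ge[of "t0 + 1"] e_le[of "t0 + 1"] by (simp add: A_def)

lemma B_nonneg: "t > t0 \<Longrightarrow> B t \<ge> 0"
  using \<theta>_pos \<beta>_pos[of t] by (simp add: B_def)

lemma B_deriv: "t > t0 \<Longrightarrow> (B has_real_derivative (1 - e t) * a t * \<beta> t) (at t)"
proof -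
  assume t: "t > t0"
  have "(B has_real_derivative \<theta> * (2 * a t * (\<delta> + \<eta> t)) * \<beta> t + \<theta> * (a t)\<^sup>2 * \<beta>' t) (at t)"
    unfolding B_def[abs_def]
    by (auto intro!: derivative_eq_intros a_deriv \<beta>_deriv t simp: power2_eq_square algebra_simps)
  also have "\<theta> * (2 * a t * (\<delta> + \<eta> t)) * \<beta> t + \<theta> * (a t)\<^sup>2 * \<beta>' t
      = a t * (\<theta> * (2 * (\<delta> + \<eta> t) * \<beta> t + a t * \<beta>' t))"
    by (simp add: power2_eq_square algebra_simps)
  also have "\<dots> = (1 - e t) * a t * \<beta> t" unfolding growth[OF t] by simp
  finally show ?thesis .
qed

lemma scaled_z'': "t > t0 \<Longrightarrow> a t *\<^sub>R z'' t = - (\<alpha> *\<^sub>R z' t) - B t *\<^sub>R W' t - (a t * \<beta> t) *\<^sub>R V (z t)"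
proof -
  assume t: "t > t0"
  have "a t *\<^sub>R (z'' t + (\<alpha> / a t) *\<^sub>R z' t + (\<theta> * a t * \<beta> t) *\<^sub>R W' t + \<beta> t *\<^sub>R V (z t)) = 0"
    unfolding ode[OF t] by simp
  then show ?thesis
    using a_pos[OF t] by (simp add: B_def scaleR_add_right power2_eq_square mult_ac algebra_simps eq_neg_iff_add_eq_0)
qed

lemma R_deriv: "t > t0 \<Longrightarrow> (R has_vector_derivative (\<delta> + \<eta> t) *\<^sub>R z' t + a t *\<^sub>R z'' t) (at t)"
  unfolding R_def[abs_def]
  by (auto intro!: derivative_eq_intros a_deriv z'_deriv simp: add.commute)

text \<open>The terms in \<open>W' t\<close> from \<open>B_deriv\<close> with the product rule and
  from \<open>scaled_z''\<close> cancel; this is what the choice of \<open>B\<close> is for. The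
  terms in \<open>V (z t)\<close> combine to the weight \<open>e t\<close>.\<close>

lemma P_deriv:
  assumes t: "t > t0"
  shows "(P has_vector_derivative (\<delta> + \<eta> t - \<alpha>) *\<^sub>R z' t - (e t * a t * \<beta> t) *\<^sub>R V (z t)) (at t)"
proof -
  have "(P has_vector_derivative (\<delta> + \<eta> t) *\<^sub>R z' t + a t *\<^sub>R z'' t
      + (B t *\<^sub>R W' t + ((1 - e t) * a t * \<beta> t) *\<^sub>R V (z t))) (at t)"
    unfolding P_def[abs_def]
    by (intro has_vector_derivative_add has_vector_derivative_scaleR R_deriv B_deriv Vz_deriv t)
  then show ?thesis
    unfolding scaled_z''[OF t] by (simp add: algebra_simps)
qed

text \<open>Completing the square leaves, besides squares, a multiple of
  \<open>inner (z t - p) (P t - R t)\<close>, which is nonnegative because \<open>P t - R t\<close>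
  is a nonnegative multiple of \<open>V (z t)\<close>. The bound is coercive for
  \<open>0 < \<mu> < A\<close>.\<close>

lemma energy_ge:
  assumes p: "V p = 0" and \<mu>: "\<mu> > 0" and t: "t > t0"
  shows "2 * \<mu> * (A - \<mu>) * (norm (z t - p))\<^sup>2 \<le> energy \<mu> p t"
proof -
  let ?u = "z t - p"
  have "P t - R t = B t *\<^sub>R V (z t)" by (simp add: P_def)
  then have "0 \<le> inner ?u (P t - R t)"
    using inner_zero_nonneg[OF p, of t] B_nonneg[OF t] by simp
  then have "0 \<le> \<mu> * inner ?u (P t - R t)" using \<mu> by simp
  moreover have "energy \<mu> p t = (norm ((2 * \<mu>) *\<^sub>R ?u + P t + R t))\<^sup>2 / 2 + (norm (P t - R t))\<^sup>2 / 2
      + 2 * \<mu> * inner ?u (P t - R t) + 2 * \<mu> * (A - \<mu>) * (norm ?u)\<^sup>2"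
  proof -
    have "energy \<mu> p t = (norm ((2 * \<mu>) *\<^sub>R u + p' + r))\<^sup>2 / 2 + (norm (p' - r))\<^sup>2 / 2
      + 2 * \<mu> * inner u (p' - r) + 2 * \<mu> * (A - \<mu>) * (norm u)\<^sup>2"
      if "u = ?u" "p' = P t" "r = R t" for u p' r
      unfolding energy_def \<phi>_def \<psi>_def that[symmetric] power2_norm_eq_inner
      by (simp add: inner_add inner_diff inner_commute field_simps)
    then show ?thesis by blast
  qed
  moreover have "(norm ((2 * \<mu>) *\<^sub>R ?u + P t + R t))\<^sup>2 \<ge> 0" "(norm (P t - R t))\<^sup>2 \<ge> 0" by auto
  ultimately show ?thesis by linarith
qed

text \<open>Here \<open>s\<close> measures the deviation of \<open>\<mu>\<close> from its central
  value, at which the quadratic form in \<open>z'\<close> and \<open>V z\<close> has mixed weight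
  \<open>e t\<close> up to \<open>\<eta>\<close>. Monotonicity disposes of the terms in
  \<open>inner (z t - p) (V (z t))\<close> and \<open>inner (z' t) (W' t)\<close>.\<close>

lemma energy_deriv_le:
  assumes p: "V p = 0" and t: "t > t0"
    and \<mu>: "\<mu> > 0" "2 * \<mu> * \<theta> = A * \<theta> + 1 + s" and s: "\<bar>s\<bar> \<le> \<epsilon> / 16" and h: "\<bar>\<theta> * \<eta> t\<bar> \<le> \<epsilon> / 16"
  obtains D where "(energy \<mu> p has_real_derivative D) (at t)"
    and "D \<le> 16 * \<mu>\<^sup>2 * \<theta> / \<epsilon> * ((\<eta> t)\<^sup>2 / a t) * (norm (z t - p))\<^sup>2 - \<epsilon> / (12 * \<theta>) * (\<psi> t / a t)"
proof -
  define u v w where "u = z t - p" and "v = z' t" and "w = V (z t)"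
  \<comment> \<open>These are the norms of \<open>R t\<close> and \<open>P t - R t\<close> divided
    by \<open>a t\<close>.\<close>
  define x y where "x = norm v" and "y = \<theta> * a t * \<beta> t * norm w"
  define \<xi> where "\<xi> = \<theta> * a t * \<beta> t * inner v w"
  have a: "a t > 0" and \<beta>: "\<beta> t > 0" using a_pos \<beta>_pos t by auto
  have e: "e t > 0" using e_ge[OF t] \<epsilon>_pos by linarith
  have norm_norm: "norm k * norm k = inner k k" for k :: 'a
    by (simp add: power2_norm_eq_inner flip: power2_eq_square)
  let ?P' = "(\<delta> + \<eta> t - \<alpha>) *\<^sub>R v - (e t * a t * \<beta> t) *\<^sub>R w"
  let ?R' = "(\<delta> + \<eta> t) *\<^sub>R v + a t *\<^sub>R z'' t"
  define D where "D = 4 * \<mu> * (A / 2 * (inner u v + inner v u) + (inner u ?P' + inner v (P t)))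
    + (inner (P t) ?P' + inner ?P' (P t) + (inner (R t) ?R' + inner ?R' (R t)))"
  have u_deriv: "((\<lambda>t. z t - p) has_vector_derivative v) (at t)"
    unfolding v_def by (auto intro!: derivative_eq_intros z_deriv t)
  have D: "(energy \<mu> p has_real_derivative D) (at t)"
    unfolding energy_def[abs_def] \<phi>_def \<psi>_def D_def u_def
    using P_deriv[OF t] R_deriv[OF t]
    by (intro DERIV_add DERIV_cmult has_real_derivative_inner u_deriv) (simp_all add: v_def w_def)
  have PR: "P t = a t *\<^sub>R v + B t *\<^sub>R w" "R t = a t *\<^sub>R v" by (simp_all add: P_def R_def v_def w_def)
  \<comment> \<open>The weight \<open>A / 2\<close> in \<open>\<phi>\<close> makes the terms in
    \<open>inner u v\<close> cancel up to the factor \<open>\<eta> t\<close>, since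
    \<open>A = \<alpha> - \<delta>\<close>.\<close>
  have D_eq: "D = 4 * \<mu> * (\<eta> t * inner u v) - 4 * \<mu> * (e t * a t * \<beta> t * inner u w)
      - 2 * a t * B t * inner v (W' t)
      + a t / \<theta> * (- 2 * (A * \<theta> - 1 - s) * x\<^sup>2 + 4 * (\<theta> * \<eta> t) * x\<^sup>2
          - 2 * (e t - s - \<theta> * \<eta> t) * \<xi> - 2 * e t * y\<^sup>2)"
  proof -
    have comm: "inner v u = inner u v" "inner w v = inner v w" "inner (W' t) v = inner v (W' t)"
      by (simp_all add: inner_commute)
    have s': "s = 2 * \<mu> * \<theta> - A * \<theta> - 1" using \<mu> by simp
    have x2: "x\<^sup>2 = inner v v" and y2: "y\<^sup>2 = \<theta> * (\<theta> * (a t)\<^sup>2 * (\<beta> t)\<^sup>2 * inner w w)"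
      by (simp_all add: x_def y_def power2_eq_square norm_norm mult_ac)
    define K where "K = - 4 * (A - \<mu>) * inner v v + 4 * \<eta> t * inner v v
      - 2 * (e t - s - \<theta> * \<eta> t) * (a t * \<beta> t * inner v w)
      - 2 * e t * (\<theta> * (a t)\<^sup>2 * (\<beta> t)\<^sup>2 * inner w w)"
    have "- 2 * (A * \<theta> - 1 - s) * x\<^sup>2 + 4 * (\<theta> * \<eta> t) * x\<^sup>2
          - 2 * (e t - s - \<theta> * \<eta> t) * \<xi> - 2 * e t * y\<^sup>2 = \<theta> * K"
      unfolding x2 y2 \<xi>_def K_def s' by (simp add: algebra_simps)
    then have "a t / \<theta> * (- 2 * (A * \<theta> - 1 - s) * x\<^sup>2 + 4 * (\<theta> * \<eta> t) * x\<^sup>2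
          - 2 * (e t - s - \<theta> * \<eta> t) * \<xi> - 2 * e t * y\<^sup>2) = a t * K"
      using \<theta>_pos by simp
    moreover have "D = 4 * \<mu> * (\<eta> t * inner u v) - 4 * \<mu> * (e t * a t * \<beta> t * inner u w)
      - 2 * a t * B t * inner v (W' t) + a t * K"
      unfolding D_def K_def scaled_z''[OF t] PR s'
      unfolding v_def[symmetric] w_def[symmetric] A_def B_def
      unfolding inner_add_left inner_add_right inner_diff_left inner_diff_right inner_minus_left
        inner_minus_right inner_scaleR_left inner_scaleR_right comm
      by algebra
    ultimately show ?thesis by simp
  qed
  have "0 \<le> 4 * \<mu> * (e t * a t * \<beta> t * inner u w)"
    using inner_zero_nonneg[OF p, of t] \<mu> e a \<beta> by (simp add: u_def w_def)
  moreover have "0 \<le> 2 * a t * B t * inner v (W' t)"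
    using monotone_inner_derivative_nonneg[OF V_mono z_deriv[OF t] Vz_deriv[OF t]] a B_nonneg[OF t]
    by (simp add: v_def)
  moreover have "a t / \<theta> * (- 2 * (A * \<theta> - 1 - s) * x\<^sup>2 + 4 * (\<theta> * \<eta> t) * x\<^sup>2
          - 2 * (e t - s - \<theta> * \<eta> t) * \<xi> - 2 * e t * y\<^sup>2) \<le> a t / \<theta> * (- (\<epsilon> / 2) * (x\<^sup>2 + y\<^sup>2))"
  proof (intro mult_left_mono perturbed_quadratic_form_le s h)
    have "\<bar>\<xi>\<bar> = \<theta> * a t * \<beta> t * \<bar>inner v w\<bar>"
      using \<theta>_pos a \<beta> by (simp add: \<xi>_def abs_mult)
    also have "\<dots> \<le> \<theta> * a t * \<beta> t * (norm v * norm w)"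
      using \<theta>_pos a \<beta> by (intro mult_left_mono Cauchy_Schwarz_ineq2) auto
    also have "\<dots> = x * y" by (simp add: x_def y_def)
    finally show "\<bar>\<xi>\<bar> \<le> x * y" .
  qed (use e_ge[OF t] e_le[OF t] \<theta>_pos a \<beta> in \<open>auto simp: x_def y_def A_def\<close>)
  moreover have "4 * \<mu> * (\<eta> t * inner u v)
      \<le> a t * \<epsilon> / (4 * \<theta>) * x\<^sup>2 + 16 * \<mu>\<^sup>2 * \<theta> / \<epsilon> * ((\<eta> t)\<^sup>2 / a t) * (norm u)\<^sup>2"
  proof -
    \<comment> \<open>Young's inequality as a completed square: \<open>c\<close> is chosen so that
      the cross term is the one above and only half of the available \<open>x\<^sup>2\<close>
      dissipation is spent.\<close>
    define c where "c = 8 * \<mu> * \<bar>\<eta> t\<bar> * \<theta> / (a t * \<epsilon>)"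
    have "\<eta> t * inner u v \<le> \<bar>\<eta> t\<bar> * (norm u * x)"
      unfolding x_def using Cauchy_Schwarz_ineq2[of u v]
      by (metis abs_ge_self abs_ge_zero abs_mult mult_left_mono order_trans)
    then have "4 * \<mu> * (\<eta> t * inner u v) \<le> 4 * \<mu> * (\<bar>\<eta> t\<bar> * (norm u * x))"
      using \<mu> by simp
    moreover have "0 \<le> a t * \<epsilon> / (4 * \<theta>) * (x - c * norm u)\<^sup>2"
      using a \<epsilon>_pos \<theta>_pos by simp
    moreover have "a t * \<epsilon> / (4 * \<theta>) * (x - c * norm u)\<^sup>2 = a t * \<epsilon> / (4 * \<theta>) * x\<^sup>2
       - 4 * \<mu> * (\<bar>\<eta> t\<bar> * (norm u * x)) + 16 * \<mu>\<^sup>2 * \<theta> / \<epsilon> * ((\<eta> t)\<^sup>2 / a t) * (norm u)\<^sup>2"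
      using a \<epsilon>_pos \<theta>_pos by (simp add: c_def field_simps power2_eq_square)
    ultimately show ?thesis by linarith
  qed
  \<comment> \<open>The other half controls \<open>\<psi>\<close>: splitting \<open>P t\<close> into
    \<open>R t\<close> and \<open>P t - R t\<close> gives the factor \<open>3\<close>, hence
    \<open>12 = 3 * 4\<close>.\<close>
  moreover have "\<epsilon> / (12 * \<theta>) * (\<psi> t / a t) \<le> a t * \<epsilon> / (4 * \<theta>) * (x\<^sup>2 + y\<^sup>2)"
  proof -
    have "inner (P t) (P t) \<le> 2 * inner (R t) (R t) + 2 * inner (P t - R t) (P t - R t)"
      using inner_ge_zero[of "2 *\<^sub>R R t - P t"] by (simp add: inner_diff inner_commute)
    moreover have "inner (R t) (R t) = (a t)\<^sup>2 * x\<^sup>2" "inner (P t - R t) (P t - R t) = (a t)\<^sup>2 * y\<^sup>2"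
      by (simp_all add: PR B_def x_def y_def power2_eq_square norm_norm)
    moreover have "3 * (a t)\<^sup>2 * (x\<^sup>2 + y\<^sup>2) = 3 * ((a t)\<^sup>2 * x\<^sup>2) + 3 * ((a t)\<^sup>2 * y\<^sup>2)"
      by (simp add: distrib_left)
    moreover have "0 \<le> (a t)\<^sup>2 * y\<^sup>2" by simp
    ultimately have "\<psi> t \<le> 3 * (a t)\<^sup>2 * (x\<^sup>2 + y\<^sup>2)"
      unfolding \<psi>_def by linarith
    then have "\<epsilon> / (12 * \<theta>) * (\<psi> t / a t) \<le> \<epsilon> / (12 * \<theta>) * (3 * (a t)\<^sup>2 * (x\<^sup>2 + y\<^sup>2) / a t)"
      using \<epsilon>_pos \<theta>_pos a by (intro mult_left_mono divide_right_mono) auto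
    also have "\<dots> = a t * \<epsilon> / (4 * \<theta>) * (x\<^sup>2 + y\<^sup>2)"
      using a \<theta>_pos by (simp add: power2_eq_square field_simps)
    finally show ?thesis .
  qed
  moreover have "a t / \<theta> * (- (\<epsilon> / 2) * (x\<^sup>2 + y\<^sup>2))
      = - (a t * \<epsilon> / (4 * \<theta>) * x\<^sup>2) - a t * \<epsilon> / (4 * \<theta>) * y\<^sup>2 - a t * \<epsilon> / (4 * \<theta>) * (x\<^sup>2 + y\<^sup>2)"
    using \<theta>_pos by (simp add: field_simps)
  moreover have "0 \<le> a t * \<epsilon> / (4 * \<theta>) * y\<^sup>2" using a \<epsilon>_pos \<theta>_pos by simp
  ultimately have "D \<le> 16 * \<mu>\<^sup>2 * \<theta> / \<epsilon> * ((\<eta> t)\<^sup>2 / a t) * (norm u)\<^sup>2 - \<epsilon> / (12 * \<theta>) * (\<psi> t / a t)"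
    unfolding D_eq by linarith
  then show ?thesis using that D by (simp add: u_def)
qed


text \<open>By coercivity the error in \<open>energy_deriv_le\<close> is at most an integrable
  multiple of the energy itself, so a Gronwall argument makes a rescaled energy nonincreasing. The
  remaining dissipation forces any limit of \<open>\<psi>\<close> to vanish.\<close>

lemma energy_limit:
  assumes p: "V p = 0" and \<mu>: "2 * \<mu> * \<theta> = A * \<theta> + 1 + s" and s: "\<bar>s\<bar> \<le> \<epsilon> / 16"
  shows "\<exists>l. (energy \<mu> p \<longlongrightarrow> l) at_top"
    and "\<exists>K. \<forall>\<^sub>F t in at_top. norm (z t - p) \<le> K"
    and "(\<psi> \<longlongrightarrow> L) at_top \<Longrightarrow> L = 0"
proof -
  \<comment> \<open>These two quantities are \<open>2 * \<mu> * \<theta>\<close> and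
    \<open>2 * (A - \<mu>) * \<theta>\<close>, so \<open>0 < \<mu> < A\<close>.\<close>
  have "A * \<theta> + 1 + s > 0" "A * \<theta> - 1 - s > 0" using Q_ge s \<epsilon>_pos by linarith+
  then have "2 * \<mu> * \<theta> > 0" "2 * (A - \<mu>) * \<theta> > 0"
    using \<mu> by (simp_all add: algebra_simps)
  then have \<mu>_pos: "\<mu> > 0" and \<mu>_less: "A - \<mu> > 0"
    using \<theta>_pos by (simp_all add: zero_less_mult_iff)
  define C where "C = 2 * \<mu> * (A - \<mu>)"
  define c where "c = \<epsilon> / (12 * \<theta>)"
  define k where "k = 16 * \<mu>\<^sup>2 * \<theta> / \<epsilon> / C"
  have C: "C > 0" and c: "c > 0" and k: "k \<ge> 0"
    using \<mu>_pos \<mu>_less \<epsilon>_pos \<theta>_pos by (simp_all add: C_def c_def k_def)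
  have ge: "C * (norm (z t - p))\<^sup>2 \<le> energy \<mu> p t" if "t > t0" for t
    using energy_ge[OF p \<mu>_pos that] by (simp add: C_def)
  have nonneg: "0 \<le> energy \<mu> p t" if "t > t0" for t
    using ge[OF that] C by (meson less_imp_le mult_nonneg_nonneg order_trans zero_le_power2)
  have "((\<lambda>t. \<bar>\<theta> * \<eta> t\<bar>) \<longlongrightarrow> \<bar>\<theta> * 0\<bar>) at_top" by (intro tendsto_intros \<eta>_lim)
  then have "\<forall>\<^sub>F t in at_top. \<bar>\<theta> * \<eta> t\<bar> < \<epsilon> / 16"
    by (rule order_tendstoD(2)) (use \<epsilon>_pos in simp)
  then have "\<forall>\<^sub>F t in at_top. \<bar>\<theta> * \<eta> t\<bar> < \<epsilon> / 16 \<and> t > t0"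
    using eventually_gt_at_top by (rule eventually_conj)
  then obtain T where T: "\<And>t. t \<ge> T \<Longrightarrow> \<bar>\<theta> * \<eta> t\<bar> \<le> \<epsilon> / 16" "\<And>t. t \<ge> T \<Longrightarrow> t > t0"
    by (auto simp: eventually_at_top_linorder intro: less_imp_le)
  \<comment> \<open>The integrating factor: its logarithmic derivative
    \<open>- k * (\<eta> t)\<^sup>2 / a t\<close> cancels the error. It tends to \<open>1\<close>,
    so \<open>F\<close> and the energy have the same limit.\<close>
  define F where "F t = energy \<mu> p t * exp (k * m t)" for t
  have ex: "\<exists>D. (F has_real_derivative D) (at t) \<and> D \<le> - c * (\<psi> t / a t)" if t: "t \<ge> T" for t
  proof -
    note t0 = T(2)[OF t]
    obtain D where D: "(energy \<mu> p has_real_derivative D) (at t)"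
      and D_le: "D \<le> 16 * \<mu>\<^sup>2 * \<theta> / \<epsilon> * ((\<eta> t)\<^sup>2 / a t) * (norm (z t - p))\<^sup>2 - \<epsilon> / (12 * \<theta>) * (\<psi> t / a t)"
      by (rule energy_deriv_le[OF p t0 \<mu>_pos \<mu> s T(1)[OF t]])
    have "16 * \<mu>\<^sup>2 * \<theta> / \<epsilon> * ((\<eta> t)\<^sup>2 / a t) * (norm (z t - p))\<^sup>2
        = k * ((\<eta> t)\<^sup>2 / a t) * (C * (norm (z t - p))\<^sup>2)"
      using C by (simp add: k_def)
    also have "\<dots> \<le> k * ((\<eta> t)\<^sup>2 / a t) * energy \<mu> p t"
      using k a_pos[OF t0] by (intro mult_left_mono ge t0) auto
    finally have le: "D - k * ((\<eta> t)\<^sup>2 / a t) * energy \<mu> p t \<le> - (c * (\<psi> t / a t))"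
      using D_le by (simp add: c_def)
    have "(F has_real_derivative (D - k * ((\<eta> t)\<^sup>2 / a t) * energy \<mu> p t) * exp (k * m t)) (at t)"
      unfolding F_def
      by (rule derivative_eq_intros D m_deriv[OF t0] refl)+ (simp add: algebra_simps)
    moreover have "(D - k * ((\<eta> t)\<^sup>2 / a t) * energy \<mu> p t) * exp (k * m t) \<le> - (c * (\<psi> t / a t)) * exp (k * m t)"
      by (intro mult_right_mono le) simp
    \<comment> \<open>As \<open>m\<close> is nonnegative, the factor is at least \<open>1\<close>
      and does not weaken the dissipation.\<close>
    moreover have "c * (\<psi> t / a t) * 1 \<le> c * (\<psi> t / a t) * exp (k * m t)"
      using c a_pos[OF t0] k m_nonneg[OF t0] by (intro mult_left_mono) (auto simp: \<psi>_def)
    ultimately show ?thesis by (intro exI conjI) (assumption, simp)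
  qed
  then obtain F' where F: "\<And>t. t \<ge> T \<Longrightarrow> (F has_real_derivative F' t) (at t)"
    and F'_le: "\<And>t. t \<ge> T \<Longrightarrow> F' t \<le> - c * (\<psi> t / a t)"
    by metis
  have F_nonneg: "0 \<le> F t" if "t \<ge> T" for t
    using nonneg[OF T(2)[OF that]] by (simp add: F_def)
  have \<psi>_nonneg: "0 \<le> \<psi> t" for t by (simp add: \<psi>_def)
  have F_dec: "F t \<le> F u" if "T \<le> u" "u \<le> t" for u t
  proof (rule DERIV_nonpos_imp_nonincreasing[OF that(2)])
    fix x assume "u \<le> x" "x \<le> t"
    then have x: "x \<ge> T" using that by simp
    have "0 \<le> c * (\<psi> x / a x)" using c \<psi>_nonneg a_pos[OF T(2)[OF x]] by simp
    then have "F' x \<le> 0" using F'_le[OF x] by simp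
    then show "\<exists>y. (F has_real_derivative y) (at x) \<and> y \<le> 0" using F[OF x] by blast
  qed
  obtain l where l: "(F \<longlongrightarrow> l) at_top"
    using antimono_bounded_below_convergent[of T F 0] F_dec F_nonneg by blast
  have "((\<lambda>t. F t * exp (- (k * m t))) \<longlongrightarrow> l * exp (- (k * 0))) at_top"
    by (intro tendsto_intros l m_lim)
  moreover have "(\<lambda>t. F t * exp (- (k * m t))) = energy \<mu> p"
    by (simp add: F_def fun_eq_iff flip: exp_add)
  ultimately show "\<exists>l. (energy \<mu> p \<longlongrightarrow> l) at_top" by auto
  show "\<exists>K. \<forall>\<^sub>F t in at_top. norm (z t - p) \<le> K"
  proof (intro exI)
    show "\<forall>\<^sub>F t in at_top. norm (z t - p) \<le> sqrt (F T / C)"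
      using eventually_ge_at_top[of T]
    proof eventually_elim
      case (elim t)
      have "energy \<mu> p t * 1 \<le> F t"
        unfolding F_def using nonneg T(2)[OF elim] k m_nonneg by (intro mult_left_mono) auto
      then have "C * (norm (z t - p))\<^sup>2 \<le> F T"
        using ge[OF T(2)[OF elim]] F_dec[of T t] elim by simp
      then show ?case using C by (intro real_le_rsqrt) (simp add: field_simps)
    qed
  qed
  show "L = 0" if "(\<psi> \<longlongrightarrow> L) at_top"
    by (rule dissipation_limit_zero[OF F F_nonneg F'_le c a_pos[OF T(2)] g_deriv[OF T(2)] g_lim \<psi>_nonneg that])
qed

text \<open>The second to fourth claims become the rates with \<open>\<rho> = r\<close>; the last,
  for an arbitrary zero \<open>p\<close>, is the hypothesis of Opial's argument.\<close>

lemma asymptotics: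
  assumes p: "V p = 0"
  shows "bounded (z ` {t0..})"
    and "((\<lambda>t. a t * norm (z' t)) \<longlongrightarrow> 0) at_top"
    and "((\<lambda>t. (a t)\<^sup>2 * \<beta> t * norm (V (z t))) \<longlongrightarrow> 0) at_top"
    and "((\<lambda>t. (a t)\<^sup>2 * \<beta> t * inner (z t - p) (V (z t))) \<longlongrightarrow> 0) at_top"
    and "\<exists>l. ((\<lambda>t. norm (z t - p)) \<longlongrightarrow> l) at_top"
proof -
  \<comment> \<open>The central weight and the largest admissible perturbation of it. The energy is
    affine in the weight, so two weights determine \<open>\<phi>\<close> and
    \<open>\<psi>\<close>.\<close>
  define \<mu> \<nu> where "\<mu> = (A * \<theta> + 1) / (2 * \<theta>)" and "\<nu> = (A * \<theta> + 1 + \<epsilon> / 16) / (2 * \<theta>)"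
  have \<mu>: "2 * \<mu> * \<theta> = A * \<theta> + 1 + 0" and \<nu>: "2 * \<nu> * \<theta> = A * \<theta> + 1 + \<epsilon> / 16"
    using \<theta>_pos by (simp_all add: \<mu>_def \<nu>_def)
  have "2 * \<mu> * \<theta> < 2 * \<nu> * \<theta>" unfolding \<mu> \<nu> using \<epsilon>_pos by simp
  then have "\<mu> \<noteq> \<nu>" by auto
  obtain l1 l2 where l1: "(energy \<mu> p \<longlongrightarrow> l1) at_top" and l2: "(energy \<nu> p \<longlongrightarrow> l2) at_top"
    using energy_limit(1)[OF p \<mu>] energy_limit(1)[OF p \<nu>] \<epsilon>_pos by auto
  define l3 where "l3 = (l1 - l2) / (4 * (\<mu> - \<nu>))"
  have "((\<lambda>t. (energy \<mu> p t - energy \<nu> p t) / (4 * (\<mu> - \<nu>))) \<longlongrightarrow> l3) at_top"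
    unfolding l3_def using \<open>\<mu> \<noteq> \<nu>\<close> by (intro tendsto_intros l1 l2) simp
  moreover have "(\<lambda>t. (energy \<mu> p t - energy \<nu> p t) / (4 * (\<mu> - \<nu>))) = \<phi> p"
    using \<open>\<mu> \<noteq> \<nu>\<close> by (simp add: energy_def fun_eq_iff field_simps)
  ultimately have \<phi>: "(\<phi> p \<longlongrightarrow> l3) at_top" by simp
  have "((\<lambda>t. energy \<mu> p t - 4 * \<mu> * \<phi> p t) \<longlongrightarrow> l1 - 4 * \<mu> * l3) at_top"
    by (intro tendsto_intros l1 \<phi>)
  then have "(\<psi> \<longlongrightarrow> l1 - 4 * \<mu> * l3) at_top" by (simp add: energy_def)
  then have \<psi>: "(\<psi> \<longlongrightarrow> 0) at_top"
    using energy_limit(3)[OF p \<mu>] \<epsilon>_pos by fastforce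
  then have sqrt_\<psi>: "((\<lambda>t. sqrt (\<psi> t)) \<longlongrightarrow> 0) at_top"
    using tendsto_real_sqrt by fastforce
  have "norm (norm (P t)) \<le> sqrt (\<psi> t)" "norm (norm (R t)) \<le> sqrt (\<psi> t)" for t
    by (simp_all add: \<psi>_def norm_eq_sqrt_inner)
  then have P: "((\<lambda>t. norm (P t)) \<longlongrightarrow> 0) at_top" and R: "((\<lambda>t. norm (R t)) \<longlongrightarrow> 0) at_top"
    by (auto intro!: Lim_null_comparison[OF _ sqrt_\<psi>] always_eventually)
  show "((\<lambda>t. a t * norm (z' t)) \<longlongrightarrow> 0) at_top"
    by (rule Lim_transform_eventually[OF R], rule eventually_mono[OF eventually_gt_at_top[of t0]])
       (simp add: R_def less_imp_le[OF a_pos])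
  have "((\<lambda>t. norm (P t - R t) / \<theta>) \<longlongrightarrow> norm (0 - 0 :: 'a) / \<theta>) at_top"
    using P R \<theta>_pos by (intro tendsto_intros) (auto simp: tendsto_norm_zero_iff)
  then have "((\<lambda>t. norm (P t - R t) / \<theta>) \<longlongrightarrow> 0) at_top" by simp
  then show W: "((\<lambda>t. (a t)\<^sup>2 * \<beta> t * norm (V (z t))) \<longlongrightarrow> 0) at_top"
    by (rule Lim_transform_eventually, intro eventually_mono[OF eventually_gt_at_top[of t0]])
       (use \<theta>_pos in \<open>simp add: P_def B_def less_imp_le[OF \<beta>_pos] abs_mult\<close>)
  obtain K where K: "\<forall>\<^sub>F t in at_top. norm (z t - p) \<le> K"
    using energy_limit(2)[OF p \<mu>] \<epsilon>_pos by auto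
  have "((\<lambda>t. K * ((a t)\<^sup>2 * \<beta> t * norm (V (z t)))) \<longlongrightarrow> K * 0) at_top"
    by (intro tendsto_intros W)
  then have KW: "((\<lambda>t. K * ((a t)\<^sup>2 * \<beta> t * norm (V (z t)))) \<longlongrightarrow> 0) at_top" by simp
  show "((\<lambda>t. (a t)\<^sup>2 * \<beta> t * inner (z t - p) (V (z t))) \<longlongrightarrow> 0) at_top"
  proof (rule Lim_null_comparison[OF _ KW])
    show "\<forall>\<^sub>F t in at_top. norm ((a t)\<^sup>2 * \<beta> t * inner (z t - p) (V (z t))) \<le> K * ((a t)\<^sup>2 * \<beta> t * norm (V (z t)))"
      using K eventually_gt_at_top[of t0]
    proof eventually_elim
      case (elim t)
      have "\<bar>inner (z t - p) (V (z t))\<bar> \<le> norm (z t - p) * norm (V (z t))"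
        by (rule Cauchy_Schwarz_ineq2)
      also have "\<dots> \<le> K * norm (V (z t))" using elim by (intro mult_right_mono) auto
      finally have "(a t)\<^sup>2 * \<beta> t * \<bar>inner (z t - p) (V (z t))\<bar> \<le> (a t)\<^sup>2 * \<beta> t * (K * norm (V (z t)))"
        using \<beta>_pos[OF elim(2)] by (intro mult_left_mono) auto
      then show ?case using \<beta>_pos[OF elim(2)] by (simp add: abs_mult mult_ac)
    qed
  qed
  have "((\<lambda>t. K * norm (P t)) \<longlongrightarrow> K * 0) at_top" by (intro tendsto_intros P)
  then have KP: "((\<lambda>t. K * norm (P t)) \<longlongrightarrow> 0) at_top" by simp
  have uP: "((\<lambda>t. inner (z t - p) (P t)) \<longlongrightarrow> 0) at_top"
  proof (rule Lim_null_comparison[OF _ KP])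
    show "\<forall>\<^sub>F t in at_top. norm (inner (z t - p) (P t)) \<le> K * norm (P t)"
      using K
    proof eventually_elim
      case (elim t)
      have "norm (inner (z t - p) (P t)) \<le> norm (z t - p) * norm (P t)"
        using Cauchy_Schwarz_ineq2 by simp
      also have "\<dots> \<le> K * norm (P t)" using elim by (intro mult_right_mono) auto
      finally show ?case .
    qed
  qed
  have "A * \<theta> > 0" using Q_ge \<epsilon>_pos by linarith
  then have A: "A > 0" using \<theta>_pos by (simp add: zero_less_mult_iff)
  \<comment> \<open>Removing the vanishing mixed term from \<open>\<phi>\<close> leaves
    \<open>A / 2\<close> times the squared distance to \<open>p\<close>.\<close>
  have "((\<lambda>t. sqrt (2 / A * (\<phi> p t - inner (z t - p) (P t)))) \<longlongrightarrow> sqrt (2 / A * (l3 - 0))) at_top"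
    by (intro tendsto_intros \<phi> uP)
  moreover have "(\<lambda>t. sqrt (2 / A * (\<phi> p t - inner (z t - p) (P t)))) = (\<lambda>t. norm (z t - p))"
    using A by (simp add: \<phi>_def norm_eq_sqrt_inner)
  ultimately show "\<exists>l. ((\<lambda>t. norm (z t - p)) \<longlongrightarrow> l) at_top" by auto
  obtain T where T: "\<And>t. t \<ge> T \<Longrightarrow> norm (z t - p) \<le> K"
    using K by (auto simp: eventually_at_top_linorder)
  \<comment> \<open>The bound \<open>K\<close> holds only from \<open>T\<close> on; the initial
    segment is covered by compactness.\<close>
  have "bounded (z ` {t0..T} \<union> cball p K)"
    by (intro bounded_Un[THEN iffD2] conjI bounded_cball compact_imp_bounded compact_continuous_image
        continuous_on_subset[OF z_cont]) auto
  moreover have "z ` {t0..} \<subseteq> z ` {t0..T} \<union> cball p K"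
  proof (rule image_subsetI)
    fix t assume "t \<in> {t0..}"
    then show "z t \<in> z ` {t0..T} \<union> cball p K"
      using T[of t] by (cases "t \<le> T") (auto simp: dist_norm norm_minus_commute)
  qed
  ultimately show "bounded (z ` {t0..})" by (rule bounded_subset)
qed

end

section \<open>Convergence rates\<close>

lemma smallo_inverseI:
  fixes f w :: "real \<Rightarrow> real"
  assumes lim: "((\<lambda>t. w t * f t) \<longlongrightarrow> 0) at_top" and pos: "\<forall>\<^sub>F t in at_top. w t > 0"
  shows "f \<in> o[at_top](\<lambda>t. 1 / w t)"
proof (rule smalloI_tendsto)
  show "((\<lambda>t. f t / (1 / w t)) \<longlongrightarrow> 0) at_top" using lim by (simp add: mult.commute)
  show "\<forall>\<^sub>F t in at_top. 1 / w t \<noteq> 0" using pos by eventually_elim simp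
qed

text \<open>Passes from \<open>\<rho> = r\<close> to smaller exponents: powers of \<open>t\<close>
  increase with the exponent once \<open>t \<ge> 1\<close>.\<close>

lemma convergence_rates_mono:
  assumes rates: "convergence_rates V zs \<beta> r z z' \<rho>" and le: "\<rho>' \<le> \<rho>"
    and \<beta>_pos: "\<And>t. t \<ge> t0 \<Longrightarrow> \<beta> t > 0"
  shows "convergence_rates V zs \<beta> r z z' \<rho>'"
proof -
  have ev: "\<forall>\<^sub>F t in at_top. t \<ge> 1 \<and> t \<ge> t0"
    by (intro eventually_conj eventually_ge_at_top)
  have powr_le: "\<forall>\<^sub>F t in at_top. norm (1 / (t powr x * b t)) \<le> norm (1 / (t powr y * b t))"
    if "y \<le> x" and b: "\<And>t. t \<ge> t0 \<Longrightarrow> b t > 0" for x y and b :: "real \<Rightarrow> real"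
    using ev
  proof eventually_elim
    case (elim t)
    have "t powr y * b t \<le> t powr x * b t"
      using elim that by (intro mult_right_mono powr_mono less_imp_le[OF b]) auto
    then have "1 / (t powr x * b t) \<le> 1 / (t powr y * b t)"
      using elim b[of t] by (intro divide_left_mono) auto
    then show ?case using elim b[of t] by simp
  qed
  have "(\<lambda>t. 1 / (t powr (\<rho> + r) * \<beta> t)) \<in> O[at_top](\<lambda>t. 1 / (t powr (\<rho>' + r) * \<beta> t))"
    "(\<lambda>t. 1 / (t powr (2 * \<rho>) * \<beta> t)) \<in> O[at_top](\<lambda>t. 1 / (t powr (2 * \<rho>') * \<beta> t))"
    by (intro landau_o.big_mono powr_le \<beta>_pos; use le in simp)+
  moreover have "(\<lambda>t. 1 / t powr \<rho>) \<in> O[at_top](\<lambda>t. 1 / t powr \<rho>')"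
    using powr_le[OF le, of "\<lambda>_. 1"] by (intro landau_o.big_mono) simp
  ultimately show ?thesis
    using rates unfolding convergence_rates_def by (auto intro: landau_o.small_big_trans)
qed

theorem theorem2p1:
  fixes V :: "'a::{real_inner,complete_space} \<Rightarrow> 'a"
    and t0 r \<alpha> \<theta> :: real
    and \<beta> \<beta>' :: "real \<Rightarrow> real"
    and z z' z'' Vz' :: "real \<Rightarrow> 'a"
    and zs :: 'a
  assumes V_mono: "monotone_operator V"
    and V_cont: "continuous_on UNIV V"
    and t0: "t0 > 0"
    and r: "0 \<le> r" "r \<le> 1"
    and pos: "\<alpha> > 0" "\<theta> > 0"
    and param_lt1: "r < 1 \<Longrightarrow> 2 / \<alpha> < \<theta>"
    and param_eq1: "r = 1 \<Longrightarrow> 2 / (\<alpha> + 1) \<le> \<theta> \<and> \<theta> < 1 / 2"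
    and \<beta>_pos: "\<And>t. t \<ge> t0 \<Longrightarrow> \<beta> t > 0"
    and \<beta>_deriv: "\<And>t. t \<ge> t0 \<Longrightarrow> (\<beta> has_real_derivative \<beta>' t) (at t within {t0..})"
    and \<beta>'_cont: "continuous_on {t0..} \<beta>'"
    and \<beta>_mono: "mono_on {t0..} \<beta>"
    and \<beta>_growth: "(SUP t\<in>{t0..}. ereal (t powr r * (\<beta>' t / \<beta> t + 2 * r / t))) < ereal (1 / \<theta>)"
    and z_deriv: "\<And>t. t \<ge> t0 \<Longrightarrow> (z has_vector_derivative z' t) (at t within {t0..})"
    and z'_deriv: "\<And>t. t \<ge> t0 \<Longrightarrow> (z' has_vector_derivative z'' t) (at t within {t0..})"
    and Vz_deriv: "\<And>t. t \<ge> t0 \<Longrightarrow> ((\<lambda>s. V (z s)) has_vector_derivative Vz' t) (at t within {t0..})"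
    and ode: "\<And>t. t \<ge> t0 \<Longrightarrow>
        z'' t + (\<alpha> / t powr r) *\<^sub>R z' t + (\<theta> * t powr r * \<beta> t) *\<^sub>R Vz' t + \<beta> t *\<^sub>R V (z t) = 0"
    and zs: "V zs = 0"
  shows
    "(0 < r \<and> r < 1 \<longrightarrow>
        (\<forall>\<rho>. 0 < \<rho> \<and> \<rho> < r \<longrightarrow> convergence_rates V zs \<beta> r z z' \<rho>) \<and>
        (bounded (z ` {t0..}) \<longrightarrow> convergence_rates V zs \<beta> r z z' r)) \<and>
     (r = 0 \<or> r = 1 \<longrightarrow> bounded (z ` {t0..})) \<and>
     (r = 0 \<longrightarrow> convergence_rates V zs \<beta> r z z' 0) \<and>
     (r = 1 \<longrightarrow> convergence_rates V zs \<beta> r z z' 1) \<and>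
     (r = 0 \<or> r = 1 \<or> (0 < r \<and> r < 1 \<and> bounded (z ` {t0..})) \<longrightarrow>
        (\<exists>z_lim. V z_lim = 0 \<and> weakly_tendsto z z_lim at_top))"
proof -

  \<comment> \<open>Specialisation to \<open>a t = t powr r\<close>\<close>
  define \<delta> :: real where "\<delta> = (if r = 1 then 1 else 0)"
  define a where "a t = t powr r" for t :: real
  define \<eta> where "\<eta> t = (if r = 1 then 0 else r * t powr (r - 1))" for t
  \<comment> \<open>For \<open>r < 1\<close> the integrand is
    \<open>r\<^sup>2 * t powr (r - 2)\<close>, and this is its integral from \<open>t\<close> to
    infinity.\<close>
  define m where "m t = (if r = 1 then 0 else r\<^sup>2 / (1 - r) * t powr (r - 1))" for t
  define g where "g t = (if r = 1 then ln t else t powr (1 - r) / (1 - r))" for t :: real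
  define e where "e t = 1 - \<theta> * (t powr r * (\<beta>' t / \<beta> t + 2 * r / t))" for t
  \<comment> \<open>A real number strictly between the supremum and \<open>1 / \<theta>\<close>
    yields a margin \<open>\<epsilon>\<close> uniform in \<open>t\<close>.\<close>
  obtain c where c: "(SUP t\<in>{t0..}. ereal (t powr r * (\<beta>' t / \<beta> t + 2 * r / t))) < ereal c"
    and c\<theta>: "ereal c < ereal (1 / \<theta>)"
    using ereal_dense2[OF \<beta>_growth] by blast
  define \<epsilon> where "\<epsilon> = 1 - \<theta> * c"
  have \<epsilon>: "\<epsilon> > 0" using c\<theta> pos by (simp add: \<epsilon>_def field_simps)
  have le_c: "t powr r * (\<beta>' t / \<beta> t + 2 * r / t) \<le> c" if "t > t0" for t
  proof -
    have "ereal (t powr r * (\<beta>' t / \<beta> t + 2 * r / t)) \<le> (SUP t\<in>{t0..}. ereal (t powr r * (\<beta>' t / \<beta> t + 2 * r / t)))"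
      by (rule SUP_upper) (use that in simp)
    from le_less_trans[OF this c] show ?thesis by simp
  qed
  have at: "at t within {t0..} = at t" if "t > t0" for t
    using that by (intro at_within_interior) simp
  have \<beta>'_nonneg: "\<beta>' t \<ge> 0" if "t > t0" for t
    by (rule mono_on_imp_deriv_nonneg[OF \<beta>_mono]) (use \<beta>_deriv[of t] that at in auto)
  have a': "\<delta> + \<eta> t = r * t powr (r - 1)" if "t > t0" for t
    using that t0 by (simp add: \<delta>_def \<eta>_def)
  interpret flow: damped_flow V t0 \<alpha> \<theta> \<delta> \<epsilon> a \<eta> \<beta> \<beta>' e m g z z' z'' Vz'
  proof
    fix t assume t: "t > t0"
    then have t_pos: "t > 0" and t_nz: "t \<noteq> 0" using t0 by auto
    have \<beta>: "\<beta> t > 0" using \<beta>_pos t by simp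
    show "\<epsilon> \<le> e t"
      using mult_left_mono[OF le_c[OF t], of \<theta>] pos by (simp add: \<epsilon>_def e_def)
    \<comment> \<open>As \<open>\<beta>\<close> is nondecreasing, \<open>e t\<close> is at most
      \<open>1 - 2 * \<theta>\<close> for \<open>r = 1\<close> and at most \<open>1\<close> for
      \<open>r < 1\<close>. The claim then reduces to
      \<open>2 \<le> (\<alpha> + 1) * \<theta>\<close> and
      \<open>2 \<le> \<alpha> * \<theta>\<close> respectively.\<close>
    show "e t \<le> (\<alpha> - \<delta>) * \<theta> - 1"
    proof (cases "r = 1")
      case True
      have "2 \<le> (\<alpha> + 1) * \<theta>" and "\<theta> < 1 / 2"
        using param_eq1[OF True] pos by (simp_all add: field_simps)
      moreover have "0 \<le> \<theta> * (t * \<beta>' t / \<beta> t)" using \<beta>'_nonneg[OF t] \<beta> t_pos pos by simp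
      moreover have "e t = 1 - \<theta> * (t * \<beta>' t / \<beta> t) - 2 * \<theta>"
        using True t_pos by (simp add: e_def field_simps)
      ultimately show ?thesis by (simp add: \<delta>_def True algebra_simps)
    next
      case False
      then have "2 < \<alpha> * \<theta>" using param_lt1 r pos by (simp add: field_simps)
      moreover have "0 \<le> \<theta> * (t powr r * (\<beta>' t / \<beta> t + 2 * r / t))"
        using \<beta>'_nonneg[OF t] \<beta> t_pos pos r by simp
      ultimately show ?thesis using False by (simp add: \<delta>_def e_def)
    qed
    show "a t > 0" using t_pos by (simp add: a_def)
    show "(a has_real_derivative \<delta> + \<eta> t) (at t)"
      unfolding a_def a'[OF t] using t_pos by (auto intro!: derivative_eq_intros)
    show "\<beta> t > 0" by (rule \<beta>)
    show "(\<beta> has_real_derivative \<beta>' t) (at t)" using \<beta>_deriv[of t] t at by simp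
    show "\<theta> * (2 * (\<delta> + \<eta> t) * \<beta> t + a t * \<beta>' t) = (1 - e t) * \<beta> t"
      using \<beta> t_pos unfolding a'[OF t] e_def a_def by (simp add: powr_diff field_simps)
    show "(m has_real_derivative - ((\<eta> t)\<^sup>2 / a t)) (at t)"
    proof (cases "r = 1")
      case False
      have "((\<lambda>t. r\<^sup>2 / (1 - r) * t powr (r - 1)) has_real_derivative r\<^sup>2 / (1 - r) * ((r - 1) * t powr (r - 2))) (at t)"
        using t_pos False by (auto intro!: derivative_eq_intros)
      moreover have "r\<^sup>2 / (1 - r) * ((r - 1) * t powr (r - 2)) = - ((r * t powr (r - 1))\<^sup>2 / t powr r)"
      proof -
        have "(t powr (r - 1))\<^sup>2 / t powr r = t powr (r - 2)"
          using t_pos by (simp add: power2_eq_square flip: powr_add powr_diff)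
        moreover have "r\<^sup>2 / (1 - r) * ((r - 1) * x) = - (r\<^sup>2 * x)" for x
          using False by (simp add: field_simps)
        ultimately show ?thesis by (simp add: power_mult_distrib flip: times_divide_eq_right)
      qed
      ultimately show ?thesis using False by (simp add: m_def[abs_def] \<eta>_def a_def)
    qed (simp add: m_def[abs_def] \<eta>_def)
    show "m t \<ge> 0" using r by (simp add: m_def)
    show "(g has_real_derivative 1 / a t) (at t)"
    proof (cases "r = 1")
      case True
      then show ?thesis
        using t_pos by (auto simp: g_def[abs_def] a_def intro!: derivative_eq_intros)
    next
      case False
      have "((\<lambda>t. t powr (1 - r) / (1 - r)) has_real_derivative t powr (- r)) (at t)"
        using t_pos False by (auto intro!: derivative_eq_intros)
      then show ?thesis using False by (simp add: g_def[abs_def] a_def powr_minus_divide)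
    qed
    show "(z has_vector_derivative z' t) (at t)" using z_deriv[of t] t at by simp
    show "(z' has_vector_derivative z'' t) (at t)" using z'_deriv[of t] t at by simp
    show "((\<lambda>s. V (z s)) has_vector_derivative Vz' t) (at t)" using Vz_deriv[of t] t at by simp
    show "z'' t + (\<alpha> / a t) *\<^sub>R z' t + (\<theta> * a t * \<beta> t) *\<^sub>R Vz' t + \<beta> t *\<^sub>R V (z t) = 0"
      using ode[of t] t by (simp add: a_def)
  next
    have decay: "((\<lambda>t. C * t powr (r - 1)) \<longlongrightarrow> C * 0) at_top" if "r \<noteq> 1" for C
      using r that by (intro tendsto_intros tendsto_neg_powr filterlim_ident) simp
    show "(\<eta> \<longlongrightarrow> 0) at_top"
      using decay[of r] by (cases "r = 1") (simp_all add: \<eta>_def[abs_def])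
    show "(m \<longlongrightarrow> 0) at_top"
      using decay[of "r\<^sup>2 / (1 - r)"] by (cases "r = 1") (simp_all add: m_def[abs_def])
    show "filterlim g at_top at_top"
    proof (cases "r = 1")
      case True
      then show ?thesis using ln_at_top by (simp add: g_def[abs_def])
    next
      case False
      have "filterlim (\<lambda>t. inverse (1 - r) * exp ((1 - r) * ln t)) at_top at_top"
        using r False
        by (intro filterlim_tendsto_pos_mult_at_top[OF tendsto_const] ln_at_top
            filterlim_compose[OF exp_at_top]) auto
      moreover have "\<forall>\<^sub>F t in at_top. inverse (1 - r) * exp ((1 - r) * ln t) = g t"
        by (rule eventually_mono[OF eventually_gt_at_top[of 0]])
           (use False in \<open>simp add: g_def powr_def divide_inverse\<close>)
      ultimately show ?thesis by (rule filterlim_mono_eventually[OF _ order_refl order_refl])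
    qed
    show "continuous_on {t0..} z"
      unfolding continuous_on_eq_continuous_within
      by (auto intro: has_vector_derivative_continuous[OF z_deriv])
  qed (fact V_mono pos(2) \<epsilon>)+

  \<comment> \<open>Rates and weak convergence for the given system\<close>
  note asym = flow.asymptotics[OF zs]
  have ev: "\<forall>\<^sub>F t in at_top. t > t0" by (rule eventually_gt_at_top)
  have a_sq: "t powr (r + r) = (a t)\<^sup>2" for t
    by (simp only: a_def powr_add power2_eq_square)
  have rates: "convergence_rates V zs \<beta> r z z' r"
    unfolding convergence_rates_def
  proof (intro conjI smallo_inverseI)
    show "((\<lambda>t. t powr (r + r) * \<beta> t * norm (V (z t))) \<longlongrightarrow> 0) at_top"
      unfolding a_sq by (rule asym(3))
    show "((\<lambda>t. t powr (2 * r) * \<beta> t * inner (z t - zs) (V (z t))) \<longlongrightarrow> 0) at_top"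
      unfolding mult_2 a_sq by (rule asym(4))
    show "((\<lambda>t. t powr r * norm (z' t)) \<longlongrightarrow> 0) at_top"
      using asym(2) by (simp add: a_def)
  qed (use t0 \<beta>_pos in \<open>auto intro!: eventually_mono[OF ev] mult_pos_pos\<close>)
  have "((\<lambda>t. V (z t)) \<longlongrightarrow> 0) at_top"
  proof -
    \<comment> \<open>The weight \<open>(a t)\<^sup>2 * \<beta> t\<close> is nondecreasing, so its
      value at \<open>t0\<close> bounds it below and the weighted decay implies plain decay of
      \<open>V (z t)\<close>.\<close>
    define c0 where "c0 = (a t0)\<^sup>2 * \<beta> t0"
    have c0: "c0 > 0" using t0 \<beta>_pos by (simp add: c0_def a_def)
    have "((\<lambda>t. (a t)\<^sup>2 * \<beta> t * norm (V (z t)) / c0) \<longlongrightarrow> 0 / c0) at_top"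
      using c0 by (intro tendsto_intros asym(3)) simp
    then have lim: "((\<lambda>t. (a t)\<^sup>2 * \<beta> t * norm (V (z t)) / c0) \<longlongrightarrow> 0) at_top" by simp
    show ?thesis
    proof (rule Lim_null_comparison[OF _ lim], rule eventually_mono[OF ev])
      fix t assume t: "t > t0"
      have "a t0 \<le> a t" using t t0 r by (simp add: a_def powr_mono2)
      moreover have "\<beta> t0 \<le> \<beta> t" using t by (intro mono_onD[OF \<beta>_mono]) auto
      ultimately have "c0 \<le> (a t)\<^sup>2 * \<beta> t"
        unfolding c0_def using \<beta>_pos[of t0] by (intro mult_mono power_mono) (auto simp: a_def)
      then have "c0 * norm (V (z t)) \<le> (a t)\<^sup>2 * \<beta> t * norm (V (z t))"
        by (rule mult_right_mono) simp
      then show "norm (V (z t)) \<le> (a t)\<^sup>2 * \<beta> t * norm (V (z t)) / c0"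
        using c0 by (simp add: field_simps)
    qed
  qed
  then have weak: "\<exists>l. V l = 0 \<and> weakly_tendsto z l at_top"
    by (rule weakly_tendsto_zero_of_monotone_operator[OF V_mono V_cont asym(1)]) (rule flow.asymptotics(5))
  have "convergence_rates V zs \<beta> r z z' \<rho>" if "\<rho> < r" for \<rho>
    using rates by (rule convergence_rates_mono) (use that \<beta>_pos in auto)
  then show ?thesis
    using rates asym(1) weak by auto
qed

end
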